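(* Assume the weak approximation property holds with constant $\eta_w>0$: for every $\mathbf v\in\mathbb R^n$ there is $\mathbf v_c\in\mathbb R^{n_c}$ with $\|\mathbf v-P\mathbf v_c\|_D\le\eta_w\|\mathbf v\|_A$. For $\mathbf f\in\mathbb R^n$ let $\mathbf u$ be the solution of $A\mathbf u=\mathbf f$, let $\mathbf u_c\in\mathbb R^{n_c}$ be the solution of the upscaled problem $$P^T(I-\pi_f)^TA(I-\pi_f)P\,\mathbf u_c=P^T(I-\pi_f)^T\mathbf f,$$ and let $\mathbf e=\mathbf u-(I-\pi_f)P\mathbf u_c$. Then $$\|\mathbf e\|_A\le\eta_w\,\|D^{-\frac12}A\mathbf u\|.$$
   Context: $A\in\mathbb R^{n\times n}$ is symmetric positive definite (SPD), and $D\in\mathbb R^{n\times n}$ is a diagonal SPD matrix with $\mathbf v^TA\mathbf v\le\mathbf v^TD\mathbf v$ for all $\mathbf v\in\mathbb R^n$. For an SPD matrix $B$, $\|\mathbf v\|_B=\sqrt{\mathbf v^TB\mathbf v}$; $\|\cdot\|$ is the Euclidean norm. The index set $\{1,\dots,n\}$ is partitioned into nonoverlapping aggregates $\mathcal A_1,\dots,\mathcal A_{n_a}$. The prolongation $P\in\mathbb R^{n\times n_c}$, of full column rank with $1\le n_c<n$, is block diagonal with respect to this partition, with blocks $P_{\mathcal A_i}$ (rows indexed by $\mathcal A_i$). On each aggregate, let $D_{\mathcal A_i}=D|_{\mathcal A_i}$ and choose vectors that are orthonormal with respect to $D_{\mathcal A_i}$ and span the $D_{\mathcal A_i}$-orthogonal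 complement of $\operatorname{Range}(P_{\mathcal A_i})$. Extended by zero outside $\mathcal A_i$, these vectors (for all $i$) are the columns of $P_\perp\in\mathbb R^{n\times(n-n_c)}$. Thus $P_\perp^TDP=0$ and $P_\perp^TDP_\perp=I$. Define $A_f=P_\perp^TAP_\perp$ and $\pi_f=P_\perp A_f^{-1}P_\perp^TA$. *)

theory Defs
  imports "HOL-Analysis.Analysis"
begin

definition SPD :: "real^'n^'n \<Rightarrow> bool" where
  "SPD B \<longleftrightarrow> transpose B = B \<and> (\<forall>v. v \<noteq> 0 \<longrightarrow> v \<bullet> (B *v v) > 0)"

definition is_diagonal :: "real^'n^'n \<Rightarrow> bool" where
  "is_diagonal D \<longleftrightarrow> (\<forall>i j. i \<noteq> j \<longrightarrow> D $ i $ j = 0)"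

definition mnorm :: "real^'n^'n \<Rightarrow> real^'n \<Rightarrow> real" where
  "mnorm B v = sqrt (v \<bullet> (B *v v))"

(* The power -1/2 of a diagonal SPD matrix; meaningful for such matrices only. *)
definition diag_inv_sqrt :: "real^'n^'n \<Rightarrow> real^'n^'n" where
  "diag_inv_sqrt D = (\<chi> i j. if i = j then D $ i $ i powr (-1/2) else 0)"

lemma SPD_diag_pos:
  fixes D :: "real^'n^'n"
  assumes "SPD D"
  shows "D $ i $ i > 0"
proof -
  have "axis i (1::real) \<bullet> (D *v axis i 1) > 0"
    using assms by (simp add: SPD_def axis_eq_0_iff)
  then show ?thesis
    by (simp add: matrix_vector_mul_component inner_axis inner_axis')
qed

lemma diag_inv_sqrt_square:
  fixes D :: "real^'n^'n"
  assumes "SPD D" "is_diagonal D"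
  shows "diag_inv_sqrt D ** diag_inv_sqrt D ** D = mat 1"
proof -
  have pos: "D $ i $ i > 0" for i
    using SPD_diag_pos[OF assms(1)] .
  have off: "D $ i $ j = (if i = j then D $ i $ i else 0)" for i j
    using assms(2) by (auto simp: is_diagonal_def)
  have "D $ i $ i powr (-1/2) * D $ i $ i powr (-1/2) * D $ i $ i = 1" for i
    using pos[of i] by (simp add: powr_add[symmetric] powr_minus divide_simps)
  then show ?thesis
    unfolding vec_eq_iff matrix_matrix_mult_def diag_inv_sqrt_def mat_def
    by (subst off) (simp add: if_distrib[of "\<lambda>x. x * _"] if_distrib[of "\<lambda>x. _ * x"] cong: if_cong)
qed

(* Vectors on an aggregate S (a set of indices) are represented by their
   extension by zero to the full index type.  Each column j of a matrix that is
   block diagonal with respect to a partition of the row indices is assigned to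
   the aggregate c j whose diagonal block contains it. *)

definition supported_on :: "'n set \<Rightarrow> (real^'n) set" where
  "supported_on S = {v. \<forall>i. i \<notin> S \<longrightarrow> v $ i = 0}"

definition block_diagonal_wrt ::
    "'n set set \<Rightarrow> ('c \<Rightarrow> 'n set) \<Rightarrow> real^'c^'n \<Rightarrow> bool" where
  "block_diagonal_wrt \<A> c P \<longleftrightarrow>
     (\<forall>j. c j \<in> \<A>) \<and> (\<forall>i j. i \<notin> c j \<longrightarrow> P $ i $ j = 0)"

(* The range of the block of P with rows S and columns {j. c j = S}. *)
definition block_range :: "('c \<Rightarrow> 'n set) \<Rightarrow> real^'c^'n \<Rightarrow> 'n set \<Rightarrow> (real^'n) set" where
  "block_range c P S =
     {\<chi> i. if i \<in> S then \<Sum>j | c j = S. P $ i $ j * w $ j else 0 | w. True}"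

(* The bilinear form of the principal submatrix of D with index set S. *)
definition block_inner :: "real^'n^'n \<Rightarrow> 'n set \<Rightarrow> real^'n \<Rightarrow> real^'n \<Rightarrow> real" where
  "block_inner D S u v = (\<Sum>i\<in>S. \<Sum>k\<in>S. u $ i * D $ i $ k * v $ k)"

definition block_complement ::
    "real^'n^'n \<Rightarrow> ('c \<Rightarrow> 'n set) \<Rightarrow> real^'c^'n \<Rightarrow> 'n set \<Rightarrow> (real^'n) set" where
  "block_complement D c P S =
     {v \<in> supported_on S. \<forall>w \<in> block_range c P S. block_inner D S v w = 0}"

(* The columns of Q assigned to an aggregate S are extended by zero outside S,
   orthonormal with respect to D restricted to S, and span the orthogonal
   complement of the range of the block of P on S. *)
definition is_P_perp ::
    "real^'n^'n \<Rightarrow> 'n set set \<Rightarrow> ('c \<Rightarrow> 'n set) \<Rightarrow> real^'c^'n \<Rightarrow>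
     ('f \<Rightarrow> 'n set) \<Rightarrow> real^'f^'n \<Rightarrow> bool" where
  "is_P_perp D \<A> c P d Q \<longleftrightarrow>
     block_diagonal_wrt \<A> d Q \<and>
     (\<forall>S\<in>\<A>.
        (\<forall>j k. d j = S \<and> d k = S \<longrightarrow>
           block_inner D S (column j Q) (column k Q) = (if j = k then 1 else 0)) \<and>
        span {column j Q | j. d j = S} = block_complement D c P S)"

definition A_f :: "real^'n^'n \<Rightarrow> real^'f^'n \<Rightarrow> real^'f^'f" where
  "A_f A Q = transpose Q ** A ** Q"

definition pi_f :: "real^'n^'n \<Rightarrow> real^'f^'n \<Rightarrow> real^'n^'n" where
  "pi_f A Q = Q ** matrix_inv (A_f A Q) ** transpose Q ** A"

definition weak_approximation ::
    "real^'n^'n \<Rightarrow> real^'n^'n \<Rightarrow> real^'c^'n \<Rightarrow> real \<Rightarrow> bool" where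
  "weak_approximation A D P \<eta> \<longleftrightarrow>
     (\<forall>v. \<exists>v\<^sub>c. mnorm D (v - P *v v\<^sub>c) \<le> \<eta> * mnorm A v)"

end

theory Submission
  imports Defs
begin

text \<open>
  Write \<open>Q\<close> for \<open>P\<^sub>\<perp>\<close> and \<open>K = (I - \<pi>\<^sub>f) P\<close>.  Since \<open>\<pi>\<^sub>f\<close> is the \<open>A\<close>-orthogonal projection onto
  the range of \<open>Q\<close>, the range of \<open>K\<close> is \<open>A\<close>-orthogonal to the range of \<open>Q\<close>, and because the ranges of
  \<open>P\<close> and \<open>Q\<close> together fill the whole space, it is exactly the \<open>A\<close>-orthogonal complement of the
  range of \<open>Q\<close>.  The upscaled problem is the Galerkin problem on the range of \<open>K\<close>, so the error
  \<open>e\<close> is \<open>A\<close>-orthogonal to that range; hence \<open>e\<close> lies in the range of \<open>Q\<close>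
  (\<open>in_range_if_orthogonal_to_corrected\<close>).

  Two consequences give the bound.  Galerkin orthogonality turns the energy into a pairing with the
  data, which a weighted Cauchy-Schwarz inequality splits:
  \<open>\<parallel>e\<parallel>\<^sub>A\<^sup>2 = e \<bullet> A u \<le> \<parallel>e\<parallel>\<^sub>D \<parallel>D\<^bsup>-1/2\<^esup> A u\<parallel>\<close>.
  On the other hand \<open>e\<close>, being in the range of \<open>Q\<close>, is \<open>D\<close>-orthogonal to the range of \<open>P\<close>, so \<open>0\<close> is
  its best \<open>D\<close>-approximation from that range, and the weak approximation property becomes
  \<open>\<parallel>e\<parallel>\<^sub>D \<le> \<eta> \<parallel>e\<parallel>\<^sub>A\<close>.  One factor \<open>\<parallel>e\<parallel>\<^sub>A\<close> cancels.

  The aggregates matter only for the global facts about \<open>Q\<close>: \<open>Q\<^sup>T D P = 0\<close>, \<open>Q\<^sup>T D Q = I\<close>, and that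
  every vector \<open>D\<close>-orthogonal to the range of \<open>P\<close> lies in the range of \<open>Q\<close>.  They follow from the
  blockwise definition because \<open>D\<close> is diagonal, so that vectors with disjoint supports are
  \<open>D\<close>-orthogonal and cutting a vector down to an aggregate commutes with \<open>D\<close>.
\<close>

section \<open>Symmetric positive definite matrices\<close>

lemma inner_matrix_vector_transpose:
  fixes M :: "real^'m^'n"
  shows "(M *v x) \<bullet> y = x \<bullet> (transpose M *v y)"
  by (metis dot_lmul_matrix inner_commute transpose_matrix_vector)

lemma SPD_inner_commute:
  assumes "SPD B"
  shows "x \<bullet> (B *v y) = y \<bullet> (B *v x)"
  using assms by (metis SPD_def inner_commute inner_matrix_vector_transpose)

lemma SPD_inner_nonneg:
  assumes "SPD B"
  shows "0 \<le> v \<bullet> (B *v v)"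
  using assms by (cases "v = 0") (auto simp: SPD_def less_imp_le)

lemma mnorm_power2:
  assumes "SPD B"
  shows "(mnorm B v)\<^sup>2 = v \<bullet> (B *v v)"
  using SPD_inner_nonneg[OF assms] by (simp add: mnorm_def)

lemma SPD_invertible:
  assumes "SPD B"
  shows "invertible B"
proof -
  have "x = 0" if "B *v x = 0" for x
    using assms that by (metis SPD_def inner_zero_right less_irrefl)
  then show ?thesis
    using invertible_left_inverse matrix_left_invertible_ker by blast
qed

lemma matrix_inv_left_right:
  fixes N :: "real^'n^'n"
  assumes "invertible N"
  shows "matrix_inv N ** N = mat 1" and "N ** matrix_inv N = mat 1"
  using someI_ex[OF assms[unfolded invertible_def]] by (simp_all add: matrix_inv_def)

lemma SPD_congruence:
  fixes M :: "real^'m^'n"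
  assumes "SPD B" and "inj ((*v) M)"
  shows "SPD (transpose M ** B ** M)"
proof -
  have "0 < x \<bullet> ((transpose M ** B ** M) *v x)" if "x \<noteq> 0" for x
  proof -
    have "M *v x \<noteq> 0"
      using assms(2) that by (metis injD matrix_vector_mult_0_right)
    then have "0 < (M *v x) \<bullet> (B *v (M *v x))"
      using assms(1) by (simp add: SPD_def)
    then show ?thesis
      by (simp add: inner_matrix_vector_transpose matrix_vector_mul_assoc matrix_mul_assoc)
  qed
  moreover have "transpose (transpose M ** B ** M) = transpose M ** B ** M"
    using assms(1) by (simp add: SPD_def matrix_transpose_mul matrix_mul_assoc)
  ultimately show ?thesis
    by (simp add: SPD_def)
qed

text \<open>
  The \<open>B\<close>-orthogonal projection of \<open>v\<close> onto the range of \<open>M\<close> has the coefficient vector that solves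
  the normal equations \<open>M\<^sup>T B M x = M\<^sup>T B v\<close>, whose matrix is again SPD.
\<close>
lemma SPD_orthogonal_decomposition:
  fixes M :: "real^'m^'n"
  assumes "SPD B" and "inj ((*v) M)"
  obtains x where "\<And>w. (M *v w) \<bullet> (B *v (v - M *v x)) = 0"
proof -
  define N where "N = transpose M ** B ** M"
  define x where "x = matrix_inv N *v (transpose M *v (B *v v))"
  have "invertible N"
    unfolding N_def using SPD_congruence[OF assms] by (rule SPD_invertible)
  then have "N *v x = transpose M *v (B *v v)"
    by (simp add: x_def matrix_vector_mul_assoc matrix_mul_assoc matrix_inv_left_right)
  then have "transpose M *v (B *v (v - M *v x)) = 0"
    by (simp add: N_def matrix_vector_mult_diff_distrib matrix_vector_mul_assoc matrix_mul_assoc)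
  then have "(M *v w) \<bullet> (B *v (v - M *v x)) = 0" for w
    by (simp add: inner_matrix_vector_transpose)
  then show ?thesis by (rule that)
qed

text \<open>
  By Pythagoras, subtracting a vector that is \<open>B\<close>-orthogonal to \<open>v\<close> cannot decrease the norm.
\<close>
lemma mnorm_le_mnorm_diff_orthogonal:
  assumes "SPD B" and "w \<bullet> (B *v v) = 0"
  shows "mnorm B v \<le> mnorm B (v - w)"
proof -
  have "(v - w) \<bullet> (B *v (v - w)) = v \<bullet> (B *v v) + w \<bullet> (B *v w)"
    using assms(2) SPD_inner_commute[OF assms(1), of v w]
    by (simp add: matrix_vector_mult_diff_distrib inner_diff_left inner_diff_right)
  then show ?thesis
    using SPD_inner_nonneg[OF assms(1), of w] by (simp add: mnorm_def)
qed

section \<open>Diagonal matrices and aggregates\<close>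

lemma diagonal_matrix_vector_nth:
  fixes D :: "real^'n^'n"
  assumes "is_diagonal D"
  shows "(D *v v) $ i = D $ i $ i * v $ i"
proof -
  have "(\<Sum>j\<in>UNIV. D $ i $ j * v $ j) = (\<Sum>j\<in>UNIV. if j = i then D $ i $ i * v $ i else 0)"
    using assms by (intro sum.cong) (auto simp: is_diagonal_def)
  then show ?thesis
    by (simp add: matrix_vector_mul_component inner_vec_def)
qed

text \<open>
  Cauchy-Schwarz after writing \<open>x \<bullet> y\<close> as the inner product of \<open>D\<^bsup>1/2\<^esup> x\<close> and \<open>D\<^bsup>-1/2\<^esup> y\<close>.
\<close>
lemma inner_le_mnorm_times_norm_diag_inv_sqrt:
  fixes D :: "real^'n^'n"
  assumes "SPD D" and "is_diagonal D"
  shows "x \<bullet> y \<le> mnorm D x * norm (diag_inv_sqrt D *v y)"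
proof -
  have pos: "0 < D $ i $ i" for i
    using SPD_diag_pos[OF assms(1)] .
  define z :: "real^'n" where "z = (\<chi> i. sqrt (D $ i $ i) * x $ i)"
  have "is_diagonal (diag_inv_sqrt D)"
    by (simp add: is_diagonal_def diag_inv_sqrt_def)
  then have root: "(diag_inv_sqrt D *v y) $ i = y $ i / sqrt (D $ i $ i)" for i
    using pos[of i]
    by (simp add: diagonal_matrix_vector_nth diag_inv_sqrt_def powr_minus powr_half_sqrt field_simps)
  have "x \<bullet> y = z \<bullet> (diag_inv_sqrt D *v y)"
    using pos by (simp add: inner_vec_def root z_def less_imp_neq[symmetric])
  also have "\<dots> \<le> norm z * norm (diag_inv_sqrt D *v y)"
    by (rule norm_cauchy_schwarz)
  also have "norm z = mnorm D x"
  proof -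
    have "z \<bullet> z = x \<bullet> (D *v x)"
      unfolding inner_vec_def z_def
    proof (intro sum.cong refl)
      fix i
      have "(sqrt (D $ i $ i) * sqrt (D $ i $ i)) * (x $ i * x $ i) = D $ i $ i * (x $ i * x $ i)"
        using pos[of i] by simp
      then show "(\<chi> i. sqrt (D $ i $ i) * x $ i) $ i \<bullet> (\<chi> i. sqrt (D $ i $ i) * x $ i) $ i
          = x $ i \<bullet> (D *v x) $ i"
        by (simp add: diagonal_matrix_vector_nth[OF assms(2)] mult_ac)
    qed
    then show ?thesis
      by (simp add: norm_eq_sqrt_inner mnorm_def)
  qed
  finally show ?thesis .
qed

text \<open>
  For diagonal \<open>D\<close> it suffices that one argument vanishes outside \<open>S\<close>: no entry of \<open>D\<close> couples
  \<open>S\<close> to its complement.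
\<close>
lemma block_inner_supported:
  fixes D :: "real^'n^'n"
  assumes "is_diagonal D" and "u \<in> supported_on S"
  shows "block_inner D S u v = u \<bullet> (D *v v)"
proof -
  have "(\<Sum>k\<in>S. u $ i * D $ i $ k * v $ k) = u $ i * (D *v v) $ i" if "i \<in> S" for i
  proof -
    have "(\<Sum>k\<in>S. u $ i * D $ i $ k * v $ k)
        = (\<Sum>k\<in>S. if k = i then u $ i * D $ i $ i * v $ i else 0)"
      using assms(1) by (intro sum.cong) (auto simp: is_diagonal_def)
    then show ?thesis
      using that by (simp add: diagonal_matrix_vector_nth[OF assms(1)])
  qed
  then have "block_inner D S u v = (\<Sum>i\<in>S. u $ i * (D *v v) $ i)"
    by (simp add: block_inner_def)
  also have "\<dots> = (\<Sum>i\<in>UNIV. u $ i * (D *v v) $ i)"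
    using assms(2) by (intro sum.mono_neutral_left) (auto simp: supported_on_def)
  finally show ?thesis
    by (simp add: inner_vec_def)
qed

lemma inner_diagonal_disjoint_supports:
  fixes D :: "real^'n^'n"
  assumes "is_diagonal D" and "u \<in> supported_on S" and "v \<in> supported_on T" and "S \<inter> T = {}"
  shows "u \<bullet> (D *v v) = 0"
proof -
  have "u $ i = 0 \<or> v $ i = 0" for i
    using assms(2-4) by (auto simp: supported_on_def)
  then show ?thesis
    unfolding inner_vec_def
    by (intro sum.neutral ballI) (auto simp: diagonal_matrix_vector_nth[OF assms(1)])
qed

definition restrict_to :: "'n set \<Rightarrow> real^'n \<Rightarrow> real^'n" where
  "restrict_to S v = (\<chi> i. if i \<in> S then v $ i else 0)"

lemma restrict_to_supported: "restrict_to S v \<in> supported_on S"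
  by (simp add: restrict_to_def supported_on_def)

lemma inner_diagonal_restrict_to:
  fixes D :: "real^'n^'n"
  assumes "is_diagonal D"
  shows "restrict_to S u \<bullet> (D *v v) = u \<bullet> (D *v restrict_to S v)"
  unfolding inner_vec_def
  by (intro sum.cong refl) (simp add: restrict_to_def diagonal_matrix_vector_nth[OF assms])

lemma sum_restrict_to_partition:
  fixes v :: "real^'n"
  assumes "partition_on UNIV \<A>"
  shows "(\<Sum>S\<in>\<A>. restrict_to S v) = v"
proof -
  have "(\<Sum>S\<in>\<A>. restrict_to S v $ i) = v $ i" for i
  proof -
    obtain T where T: "T \<in> \<A>" "i \<in> T"
      using partition_onD1[OF assms] by blast
    have "i \<in> S \<longleftrightarrow> S = T" if "S \<in> \<A>" for S
      using partition_onD2[OF assms] T that by (auto simp: disjoint_def)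
    then have "(\<Sum>S\<in>\<A>. restrict_to S v $ i) = (\<Sum>S\<in>\<A>. if S = T then v $ i else 0)"
      by (intro sum.cong) (auto simp: restrict_to_def)
    then show ?thesis
      using T(1) by (simp add: finite)
  qed
  then show ?thesis
    by (simp add: vec_eq_iff sum_component)
qed

section \<open>Global properties of the blockwise complement\<close>

lemma column_supported:
  assumes "block_diagonal_wrt \<A> c P"
  shows "column j P \<in> supported_on (c j)"
  using assms by (simp add: block_diagonal_wrt_def supported_on_def column_def)

text \<open>
  Because \<open>P\<close> is block diagonal, the range of a block is a set of vectors \<open>P w\<close>, with \<open>w\<close> cut down to
  the columns assigned to \<open>S\<close>.
\<close>
lemma block_range_subset_range:
  fixes P :: "real^'c^'n"
  assumes "block_diagonal_wrt \<A> c P"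
  shows "block_range c P S \<subseteq> range ((*v) P)"
proof
  fix x assume "x \<in> block_range c P S"
  then obtain w where x: "x = (\<chi> i. if i \<in> S then \<Sum>j | c j = S. P $ i $ j * w $ j else 0)"
    by (auto simp: block_range_def)
  have "x $ i = (P *v (\<chi> j. if c j = S then w $ j else 0)) $ i" for i
  proof -
    have "(P *v (\<chi> j. if c j = S then w $ j else 0)) $ i
        = (\<Sum>j\<in>UNIV. if c j = S then P $ i $ j * w $ j else 0)"
      by (auto simp: matrix_vector_mult_def intro!: sum.cong)
    also have "\<dots> = (\<Sum>j | c j = S. P $ i $ j * w $ j)"
      by (simp add: sum.If_cases)
    also have "\<dots> = x $ i"
      using assms by (auto simp: x block_diagonal_wrt_def intro!: sum.neutral)
    finally show ?thesis by simp
  qed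
  then have "x = P *v (\<chi> j. if c j = S then w $ j else 0)"
    by (simp add: vec_eq_iff)
  then show "x \<in> range ((*v) P)" by blast
qed

lemma column_in_block_range:
  fixes P :: "real^'c^'n"
  assumes "block_diagonal_wrt \<A> c P"
  shows "column j P \<in> block_range c P (c j)"
proof -
  have "column j P $ i =
      (if i \<in> c j then \<Sum>k | c k = c j. P $ i $ k * (axis j 1 :: real^'c) $ k else 0)" for i
  proof -
    have "(\<Sum>k | c k = c j. P $ i $ k * (axis j 1 :: real^'c) $ k)
        = (\<Sum>k | c k = c j. if k = j then P $ i $ j else 0)"
      by (intro sum.cong) (auto simp: axis_def)
    then show ?thesis
      using assms by (auto simp: column_def block_diagonal_wrt_def)
  qed
  then show ?thesis
    unfolding block_range_def by (auto simp: vec_eq_iff)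
qed

text \<open>
  Columns in different aggregates have disjoint supports, so all products of columns
  can be computed inside a single block.
\<close>
lemma P_perp_orthonormal_columns:
  fixes Q :: "real^'f^'n"
  assumes "is_diagonal D" and "partition_on UNIV \<A>" and "is_P_perp D \<A> c P d Q"
  shows "column j Q \<bullet> (D *v column k Q) = (if j = k then 1 else 0)"
proof -
  have Q: "block_diagonal_wrt \<A> d Q"
    using assms(3) by (simp add: is_P_perp_def)
  then have mem: "d i \<in> \<A>" for i
    by (simp add: block_diagonal_wrt_def)
  show ?thesis
  proof (cases "d j = d k")
    case True
    have "block_inner D (d j) (column j Q) (column k Q) = (if j = k then 1 else 0)"
      using assms(3) mem[of j] True unfolding is_P_perp_def by metis
    then show ?thesis
      by (simp add: block_inner_supported[OF assms(1) column_supported[OF Q]])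
  next
    case False
    then have "d j \<inter> d k = {}"
      using partition_onD2[OF assms(2)] mem by (auto simp: disjoint_def)
    then show ?thesis
      using False inner_diagonal_disjoint_supports[OF assms(1) column_supported[OF Q] column_supported[OF Q]]
      by auto
  qed
qed

text \<open>
  Orthonormality of the columns says that \<open>Q\<^sup>T D\<close> is a left inverse of \<open>Q\<close>.
\<close>
lemma P_perp_inj:
  fixes Q :: "real^'f^'n"
  assumes "is_diagonal D" and "partition_on UNIV \<A>" and "is_P_perp D \<A> c P d Q"
  shows "inj ((*v) Q)"
proof -
  have "transpose Q ** (D ** Q) = mat 1"
  proof -
    have "(transpose Q ** (D ** Q)) $ j $ k = column j Q \<bullet> (D *v column k Q)" for j k
      by (simp add: matrix_matrix_mult_def matrix_vector_mult_def transpose_def column_def inner_vec_def)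
    then show ?thesis
      using P_perp_orthonormal_columns[OF assms] by (simp add: vec_eq_iff mat_def)
  qed
  then have "(transpose Q ** D) ** Q = mat 1"
    by (simp add: matrix_mul_assoc)
  then show ?thesis
    using matrix_left_invertible_injective by blast
qed

lemma P_perp_orthogonal_columns:
  fixes Q :: "real^'f^'n" and P :: "real^'c^'n"
  assumes "is_diagonal D" and "partition_on UNIV \<A>"
    and "block_diagonal_wrt \<A> c P" and "is_P_perp D \<A> c P d Q"
  shows "column j Q \<bullet> (D *v column k P) = 0"
proof -
  have Q: "block_diagonal_wrt \<A> d Q"
    using assms(4) by (simp add: is_P_perp_def)
  have mem: "d j \<in> \<A>" "c k \<in> \<A>"
    using Q assms(3) by (simp_all add: block_diagonal_wrt_def)
  show ?thesis
  proof (cases "d j = c k")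
    case True
    have "column j Q \<in> span {column i Q | i. d i = d j}"
      by (rule span_base) blast
    then have "column j Q \<in> block_complement D c P (d j)"
      using assms(4) mem(1) by (simp add: is_P_perp_def)
    then have "block_inner D (d j) (column j Q) (column k P) = 0"
      using column_in_block_range[OF assms(3), of k] True by (simp add: block_complement_def)
    then show ?thesis
      by (simp add: block_inner_supported[OF assms(1) column_supported[OF Q]])
  next
    case False
    then have "d j \<inter> c k = {}"
      using partition_onD2[OF assms(2)] mem by (auto simp: disjoint_def)
    then show ?thesis
      by (rule inner_diagonal_disjoint_supports
          [OF assms(1) column_supported[OF Q] column_supported[OF assms(3)]])
  qed
qed

lemma P_perp_orthogonal_range:
  fixes Q :: "real^'f^'n" and P :: "real^'c^'n"
  assumes "is_diagonal D" and "partition_on UNIV \<A>"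
    and "block_diagonal_wrt \<A> c P" and "is_P_perp D \<A> c P d Q"
  shows "(Q *v b) \<bullet> (D *v (P *v a)) = 0"
proof -
  have "(transpose Q ** (D ** P)) $ j $ k = column j Q \<bullet> (D *v column k P)" for j k
    by (simp add: matrix_matrix_mult_def matrix_vector_mult_def transpose_def column_def inner_vec_def)
  then have "transpose Q ** (D ** P) = 0"
    using P_perp_orthogonal_columns[OF assms] by (simp add: vec_eq_iff)
  then show ?thesis
    by (simp add: inner_matrix_vector_transpose matrix_vector_mul_assoc)
qed

text \<open>
  The part of \<open>v\<close> inside an aggregate is \<open>D\<close>-orthogonal to the range of the block of \<open>P\<close>,
  hence a combination of the columns of \<open>Q\<close> belonging to that aggregate; \<open>v\<close> is the sum of
  these parts.
\<close>
lemma in_range_P_perp: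
  fixes Q :: "real^'f^'n" and P :: "real^'c^'n"
  assumes "is_diagonal D" and "partition_on UNIV \<A>"
    and "block_diagonal_wrt \<A> c P" and "is_P_perp D \<A> c P d Q"
    and orth: "\<And>w. v \<bullet> (D *v (P *v w)) = 0"
  shows "v \<in> range ((*v) Q)"
proof -
  have cols: "{column j Q | j. d j = S} \<subseteq> range ((*v) Q)" for S
    using matrix_vector_mult_basis[of Q] by (auto simp: image_iff) metis
  have sub: "subspace (range ((*v) Q))"
    by (intro linear_subspace_image matrix_vector_mul_linear subspace_UNIV)
  have "restrict_to S v \<in> range ((*v) Q)" if S: "S \<in> \<A>" for S
  proof -
    have "restrict_to S v \<in> block_complement D c P S"
      unfolding block_complement_def
    proof (intro CollectI conjI ballI)
      show "restrict_to S v \<in> supported_on S"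
        by (rule restrict_to_supported)
      fix w assume w: "w \<in> block_range c P S"
      then have "restrict_to S w = w"
        by (auto simp: block_range_def restrict_to_def vec_eq_iff)
      moreover obtain a where "w = P *v a"
        using block_range_subset_range[OF assms(3)] w by blast
      ultimately have "restrict_to S v \<bullet> (D *v w) = 0"
        using orth by (simp add: inner_diagonal_restrict_to[OF assms(1)])
      then show "block_inner D S (restrict_to S v) w = 0"
        by (simp add: block_inner_supported[OF assms(1) restrict_to_supported])
    qed
    also have "\<dots> = span {column j Q | j. d j = S}"
      using assms(4) S by (simp add: is_P_perp_def)
    also have "\<dots> \<subseteq> range ((*v) Q)"
      using cols sub by (rule span_minimal)
    finally show ?thesis .
  qed
  then have "(\<Sum>S\<in>\<A>. restrict_to S v) \<in> range ((*v) Q)"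
    using sub by (intro subspace_sum)
  then show ?thesis
    by (simp add: sum_restrict_to_partition[OF assms(2)])
qed

text \<open>
  Subtracting from \<open>v\<close> its \<open>D\<close>-orthogonal projection onto the range of \<open>P\<close> leaves a vector that is
  \<open>D\<close>-orthogonal to that range, hence in the range of \<open>Q\<close>.
\<close>
lemma range_P_plus_range_P_perp:
  fixes Q :: "real^'f^'n" and P :: "real^'c^'n"
  assumes "SPD D" and "is_diagonal D" and "partition_on UNIV \<A>"
    and "inj ((*v) P)" and "block_diagonal_wrt \<A> c P" and "is_P_perp D \<A> c P d Q"
  obtains a b where "v = P *v a + Q *v b"
proof -
  obtain a where a: "\<And>w. (P *v w) \<bullet> (D *v (v - P *v a)) = 0"
    using SPD_orthogonal_decomposition[OF assms(1,4), of v] by blast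
  then have "(v - P *v a) \<bullet> (D *v (P *v w)) = 0" for w
    by (simp add: SPD_inner_commute[OF assms(1), of _ "P *v w"])
  then have "v - P *v a \<in> range ((*v) Q)"
    by (rule in_range_P_perp[OF assms(2,3,5,6)])
  then show ?thesis
    using that by (auto simp: algebra_simps)
qed

section \<open>The energy projection onto the fine space\<close>

lemma pi_f_fixes_range:
  fixes Q :: "real^'f^'n"
  assumes "SPD A" and "inj ((*v) Q)"
  shows "pi_f A Q *v (Q *v b) = Q *v b"
proof -
  have "invertible (A_f A Q)"
    unfolding A_f_def using SPD_congruence[OF assms] by (rule SPD_invertible)
  then have "pi_f A Q ** Q = Q"
    by (simp add: pi_f_def A_f_def matrix_inv_left_right flip: matrix_mul_assoc)
  then show ?thesis
    by (simp add: matrix_vector_mul_assoc)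
qed

lemma pi_f_residual_orthogonal:
  fixes Q :: "real^'f^'n"
  assumes "SPD A" and "inj ((*v) Q)"
  shows "(Q *v b) \<bullet> (A *v ((mat 1 - pi_f A Q) *v x)) = 0"
proof -
  have "invertible (A_f A Q)"
    unfolding A_f_def using SPD_congruence[OF assms] by (rule SPD_invertible)
  then have "A_f A Q ** matrix_inv (A_f A Q) ** transpose Q ** A = transpose Q ** A"
    by (simp add: matrix_inv_left_right)
  then have "transpose Q ** A ** pi_f A Q = transpose Q ** A"
    by (simp add: pi_f_def A_f_def matrix_mul_assoc)
  then have "transpose Q *v (A *v (pi_f A Q *v x)) = transpose Q *v (A *v x)"
    by (simp add: matrix_vector_mul_assoc matrix_mul_assoc)
  then show ?thesis
    by (simp add: inner_matrix_vector_transpose matrix_vector_mult_diff_rdistrib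
        matrix_vector_mult_diff_distrib)
qed

text \<open>
  Decomposing \<open>v = P a + Q b\<close> and moving \<open>\<pi>\<^sub>f P a\<close> into the second summand gives \<open>v = w + y\<close> with
  \<open>w = (I - \<pi>\<^sub>f) P a\<close> and \<open>y\<close> in the range of \<open>Q\<close>.  Both \<open>v\<close> and \<open>y\<close> are \<open>A\<close>-orthogonal to \<open>w\<close>, so
  \<open>w\<close> is \<open>A\<close>-orthogonal to itself and vanishes.
\<close>
lemma in_range_if_orthogonal_to_corrected:
  fixes Q :: "real^'f^'n" and P :: "real^'c^'n"
  assumes "SPD A" and "inj ((*v) Q)" and v: "v = P *v a + Q *v b"
    and orth: "((mat 1 - pi_f A Q) *v (P *v a)) \<bullet> (A *v v) = 0"
  shows "v \<in> range ((*v) Q)"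
proof -
  define w where "w = (mat 1 - pi_f A Q) *v (P *v a)"
  have "v - w = Q *v b + pi_f A Q *v (P *v a)"
    by (simp add: v w_def matrix_vector_mult_diff_rdistrib)
  also have "\<dots> = Q *v (b + (matrix_inv (A_f A Q) ** transpose Q ** A ** P) *v a)"
    by (simp add: pi_f_def matrix_vector_right_distrib matrix_vector_mul_assoc matrix_mul_assoc)
  finally obtain y where y: "v - w = Q *v y" by blast
  have "(v - w) \<bullet> (A *v w) = 0"
    unfolding y unfolding w_def by (rule pi_f_residual_orthogonal[OF assms(1,2)])
  then have "w \<bullet> (A *v w) = 0"
    using orth SPD_inner_commute[OF assms(1), of v w]
    by (simp add: inner_diff_left flip: w_def)
  then have "w = 0"
    using assms(1) by (metis SPD_def less_irrefl)
  then show ?thesis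
    using y by auto
qed

section \<open>The error bound\<close>

theorem theorem3p3:
  fixes A D :: "real^'n^'n"
    and P :: "real^'c^'n"
    and P_perp :: "real^'f^'n"
    and \<A> :: "'n set set"
    and c :: "'c \<Rightarrow> 'n set"
    and d :: "'f \<Rightarrow> 'n set"
    and \<eta>\<^sub>w :: real
    and f u e :: "real^'n"
    and u\<^sub>c :: "real^'c"
  assumes "SPD A"
    and "SPD D" and "is_diagonal D"
    and "\<And>v. v \<bullet> (A *v v) \<le> v \<bullet> (D *v v)"
    and "partition_on UNIV \<A>"
    and "CARD('c) < CARD('n)"
    and "CARD('f) = CARD('n) - CARD('c)"
    and "rank P = CARD('c)"
    and "block_diagonal_wrt \<A> c P"
    and "is_P_perp D \<A> c P d P_perp"
    and "\<eta>\<^sub>w > 0"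
    and "weak_approximation A D P \<eta>\<^sub>w"
    and "A *v u = f"
    and "(transpose P ** transpose (mat 1 - pi_f A P_perp) ** A
            ** (mat 1 - pi_f A P_perp) ** P) *v u\<^sub>c
         = (transpose P ** transpose (mat 1 - pi_f A P_perp)) *v f"
    and "e = u - ((mat 1 - pi_f A P_perp) ** P) *v u\<^sub>c"
  shows "mnorm A e \<le> \<eta>\<^sub>w * norm (diag_inv_sqrt D *v (A *v u))"
proof -
  define K where "K = (mat 1 - pi_f A P_perp) ** P"
  have injP: "inj ((*v) P)"
    using assms(8) by (simp add: full_rank_injective)
  have injQ: "inj ((*v) P_perp)"
    by (rule P_perp_inj[OF assms(3,5,10)])
  have e: "e = u - K *v u\<^sub>c"
    using assms(15) by (simp add: K_def)
  \<comment> \<open>The upscaled problem is \<open>K\<^sup>T A K u\<^sub>c = K\<^sup>T A u\<close>, that is, \<open>K\<^sup>T A e = 0\<close>.\<close>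
  have "transpose K *v (A *v (K *v u\<^sub>c)) = transpose K *v (A *v u)"
    using assms(14) by (simp add: K_def assms(13) matrix_transpose_mul matrix_vector_mul_assoc matrix_mul_assoc)
  then have galerkin: "(K *v w) \<bullet> (A *v e) = 0" for w
    by (simp add: e inner_matrix_vector_transpose matrix_vector_mult_diff_distrib)
  obtain a b where "e = P *v a + P_perp *v b"
    using range_P_plus_range_P_perp[OF assms(2,3,5) injP assms(9,10)] .
  moreover have "((mat 1 - pi_f A P_perp) *v (P *v a)) \<bullet> (A *v e) = 0"
    using galerkin[of a] by (simp add: K_def matrix_vector_mul_assoc)
  ultimately have "e \<in> range ((*v) P_perp)"
    by (rule in_range_if_orthogonal_to_corrected[OF assms(1) injQ])
  then have D_orth: "(P *v w) \<bullet> (D *v e) = 0" for w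
    using P_perp_orthogonal_range[OF assms(3,5,9,10)]
    by (auto simp: SPD_inner_commute[OF assms(2), of "P *v w"])

  obtain v\<^sub>c where v\<^sub>c: "mnorm D (e - P *v v\<^sub>c) \<le> \<eta>\<^sub>w * mnorm A e"
    using assms(12) by (auto simp: weak_approximation_def)
  have e_D: "mnorm D e \<le> \<eta>\<^sub>w * mnorm A e"
    using mnorm_le_mnorm_diff_orthogonal[OF assms(2) D_orth] v\<^sub>c by (rule order_trans)

  have "(mnorm A e)\<^sup>2 = (u - K *v u\<^sub>c) \<bullet> (A *v e)"
    by (simp add: mnorm_power2[OF assms(1)] flip: e)
  also have "\<dots> = e \<bullet> (A *v u)"
    using galerkin[of u\<^sub>c] by (simp add: inner_diff_left SPD_inner_commute[OF assms(1), of e])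
  also have "\<dots> \<le> mnorm D e * norm (diag_inv_sqrt D *v (A *v u))"
    by (rule inner_le_mnorm_times_norm_diag_inv_sqrt[OF assms(2,3)])
  also have "\<dots> \<le> \<eta>\<^sub>w * mnorm A e * norm (diag_inv_sqrt D *v (A *v u))"
    using e_D by (rule mult_right_mono) simp
  finally have "mnorm A e * mnorm A e
      \<le> mnorm A e * (\<eta>\<^sub>w * norm (diag_inv_sqrt D *v (A *v u)))"
    by (simp add: power2_eq_square mult_ac)
  moreover have "0 \<le> mnorm A e"
    using SPD_inner_nonneg[OF assms(1)] by (simp add: mnorm_def)
  moreover have "0 \<le> \<eta>\<^sub>w * norm (diag_inv_sqrt D *v (A *v u))"
    using assms(11) by simp
  ultimately show ?thesis
    by (cases "mnorm A e = 0") (auto simp: mult_le_cancel_left)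
qed

end
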